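(* Let $G$ be a countable discrete group and $\sigma$ a family of finite-index subgroups of $G$. Then \[ \operatorname{asdim}(\widetilde{\square}_\sigma G)=\operatorname{asdim}(\square_\sigma G)=\operatorname{asdim}(\widehat{\square}_\sigma G), \] where $\widetilde{\square}_\sigma G$ is the total box space, $\square_\sigma G$ the box space and $\widehat{\square}_\sigma G$ the box family of $G$ with respect to $\sigma$.
   Context: A coarse space is a set $X$ with a collection $\mathcal E$ of subsets of $X\times X$ (entourages) that contains the diagonal and is closed under subsets, finite unions, inverses and compositions. It is connected if $\{(x,y)\}\in\mathcal E$ for all $x,y\in X$. A coarse space $(X,\mathcal E)$ has $\operatorname{asdim}(X)\le n$ if for every $E\in\mathcal E$ there is a cover $\mathcal U$ of $X$ such that $\bigcup_{U\in\mathcal U}U\times U\in\mathcal E$, any $n+2$ distinct members of $\mathcal U$ have empty intersection, and every non-empty $A\subseteq X$ with $A\times A\subseteq E$ is contained in some $U\in\mathcal U$. A family of metric spaces $\{X_\alpha\}_\alpha$ has $\operatorname{asdim}\le n$ (uniformly) if for every $R>0$ there is $S>0$ such that every $X_\alpha$ has a cover by sets of diameter at most $S$, such that any $n+2$ distinct members have empty intersection and every non-empty subset of $X_\alpha$ of diameter at most $R$ lies in some member. In each case $\operatorname{asdim}\in\{0,1,2,\dots\}\cup\{\infty\}$ is the least such $n$, or $\infty$ if there is none. Let $G$ be a countable discrete group and $\sigma=(G_\alpha)_\alpha$ a family (repetitions allowed) of finite-index, not necessarily normal, subgroups. $G$ acts on $\bigsqcup_\alpha G/G_\alpha$ (left cosets)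 by left multiplication; let $\Delta_g=\{(x,gx):x\in\bigsqcup_\alpha G/G_\alpha\}$. The box space $\square_\sigma G$ is $\bigsqcup_\alpha G/G_\alpha$ with the smallest connected $G$-invariant coarse structure containing all $\Delta_g$, $g\in G$. The total box space $\widetilde\square_\sigma G$ is the same set with the $G$-invariant coarse structure generated by all $\Delta_g$, $g\in G$ (not required to be connected). The box family $\widehat\square_\sigma G$ is the family of metric spaces $\{(G/G_\alpha,d_{G/G_\alpha})\}_\alpha$, where $d_{G/G_\alpha}(xG_\alpha,yG_\alpha)=\inf_{h,h'\in G_\alpha}d_G(xh,yh')$ for a fixed proper (balls are finite) right-invariant metric $d_G$ on $G$. *)

theory Defs
  imports
    "HOL-Analysis.Abstract_Metric_Spaces"
    "HOL-Algebra.Left_Coset"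
    "HOL-Library.Extended_Nat"
begin

subsection \<open>Coarse structures\<close>

definition coarse_structure :: "'x set \<Rightarrow> ('x \<times> 'x) set set \<Rightarrow> bool" where
  "coarse_structure X \<E> \<longleftrightarrow>
     \<E> \<subseteq> Pow (X \<times> X) \<and>
     Id_on X \<in> \<E> \<and>
     (\<forall>E\<in>\<E>. \<forall>F. F \<subseteq> E \<longrightarrow> F \<in> \<E>) \<and>
     (\<forall>E\<in>\<E>. \<forall>F\<in>\<E>. E \<union> F \<in> \<E>) \<and>
     (\<forall>E\<in>\<E>. E\<inverse> \<in> \<E>) \<and>
     (\<forall>E\<in>\<E>. \<forall>F\<in>\<E>. E O F \<in> \<E>)"

definition coarse_connected :: "'x set \<Rightarrow> ('x \<times> 'x) set set \<Rightarrow> bool" where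
  "coarse_connected X \<E> \<longleftrightarrow> (\<forall>x\<in>X. \<forall>y\<in>X. {(x, y)} \<in> \<E>)"

text \<open>
  Invariance of a coarse structure means that the diagonal action permutes the entourages;
  the individual entourages need not be invariant subsets.
\<close>

definition coarse_invariant ::
    "('g, 'm) monoid_scheme \<Rightarrow> ('g \<Rightarrow> 'x \<Rightarrow> 'x) \<Rightarrow> ('x \<times> 'x) set set \<Rightarrow> bool" where
  "coarse_invariant G \<phi> \<E> \<longleftrightarrow>
     (\<forall>g\<in>carrier G. \<forall>E\<in>\<E>. (\<lambda>(x, y). (\<phi> g x, \<phi> g y)) ` E \<in> \<E>)"


subsection \<open>Asymptotic dimension\<close>

definition least_or_infinity :: "(nat \<Rightarrow> bool) \<Rightarrow> enat" where
  "least_or_infinity P = (if \<exists>n. P n then enat (LEAST n. P n) else \<infinity>)"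

definition is_cover :: "'x set \<Rightarrow> 'x set set \<Rightarrow> bool" where
  "is_cover X \<U> \<longleftrightarrow> \<U> \<subseteq> Pow X \<and> \<Union>\<U> = X"

definition distinct_members_disjoint :: "nat \<Rightarrow> 'x set set \<Rightarrow> bool" where
  "distinct_members_disjoint k \<U> \<longleftrightarrow>
     (\<forall>\<V>. \<V> \<subseteq> \<U> \<longrightarrow> finite \<V> \<longrightarrow> card \<V> = k \<longrightarrow> \<Inter>\<V> = {})"

definition coarse_asdim_le :: "'x set \<Rightarrow> ('x \<times> 'x) set set \<Rightarrow> nat \<Rightarrow> bool" where
  "coarse_asdim_le X \<E> n \<longleftrightarrow>
     (\<forall>E\<in>\<E>. \<exists>\<U>. is_cover X \<U> \<and> (\<Union>U\<in>\<U>. U \<times> U) \<in> \<E> \<and>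
        distinct_members_disjoint (n + 2) \<U> \<and>
        (\<forall>A. A \<noteq> {} \<longrightarrow> A \<subseteq> X \<longrightarrow> A \<times> A \<subseteq> E \<longrightarrow> (\<exists>U\<in>\<U>. A \<subseteq> U)))"

definition coarse_asdim :: "'x set \<Rightarrow> ('x \<times> 'x) set set \<Rightarrow> enat" where
  "coarse_asdim X \<E> = least_or_infinity (coarse_asdim_le X \<E>)"

definition diameter_le :: "('x \<Rightarrow> 'x \<Rightarrow> real) \<Rightarrow> 'x set \<Rightarrow> real \<Rightarrow> bool" where
  "diameter_le d A r \<longleftrightarrow> (\<forall>x\<in>A. \<forall>y\<in>A. d x y \<le> r)"

definition family_asdim_le ::
    "'i set \<Rightarrow> ('i \<Rightarrow> 'x set) \<Rightarrow> ('i \<Rightarrow> 'x \<Rightarrow> 'x \<Rightarrow> real) \<Rightarrow> nat \<Rightarrow> bool" where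
  "family_asdim_le I X d n \<longleftrightarrow>
     (\<forall>R>0. \<exists>S>0. \<forall>i\<in>I. \<exists>\<U>. is_cover (X i) \<U> \<and> (\<forall>U\<in>\<U>. diameter_le (d i) U S) \<and>
        distinct_members_disjoint (n + 2) \<U> \<and>
        (\<forall>A. A \<noteq> {} \<longrightarrow> A \<subseteq> X i \<longrightarrow> diameter_le (d i) A R \<longrightarrow> (\<exists>U\<in>\<U>. A \<subseteq> U)))"

definition family_asdim ::
    "'i set \<Rightarrow> ('i \<Rightarrow> 'x set) \<Rightarrow> ('i \<Rightarrow> 'x \<Rightarrow> 'x \<Rightarrow> real) \<Rightarrow> enat" where
  "family_asdim I X d = least_or_infinity (family_asdim_le I X d)"


subsection \<open>Box spaces\<close>

text \<open>
  A family of subgroups is a function \<open>H\<close> on an index set \<open>I\<close>. Tagging each coset with its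
  index makes the union disjoint, also when the same subgroup occurs several times.
\<close>

definition box_points ::
    "('g, 'm) monoid_scheme \<Rightarrow> 'i set \<Rightarrow> ('i \<Rightarrow> 'g set) \<Rightarrow> ('i \<times> 'g set) set" where
  "box_points G I H = (SIGMA i:I. lcosets\<^bsub>G\<^esub> (H i))"

definition box_action ::
    "('g, 'm) monoid_scheme \<Rightarrow> 'g \<Rightarrow> 'i \<times> 'g set \<Rightarrow> 'i \<times> 'g set" where
  "box_action G g = (\<lambda>(i, C). (i, g <#\<^bsub>G\<^esub> C))"

definition box_Delta ::
    "('g, 'm) monoid_scheme \<Rightarrow> 'i set \<Rightarrow> ('i \<Rightarrow> 'g set) \<Rightarrow> 'g
      \<Rightarrow> (('i \<times> 'g set) \<times> ('i \<times> 'g set)) set" where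
  "box_Delta G I H g = {(x, box_action G g x) | x. x \<in> box_points G I H}"

definition total_box_entourages ::
    "('g, 'm) monoid_scheme \<Rightarrow> 'i set \<Rightarrow> ('i \<Rightarrow> 'g set)
      \<Rightarrow> (('i \<times> 'g set) \<times> ('i \<times> 'g set)) set set" where
  "total_box_entourages G I H =
     \<Inter>{\<E>. coarse_structure (box_points G I H) \<E> \<and>
         coarse_invariant G (box_action G) \<E> \<and>
         (\<forall>g\<in>carrier G. box_Delta G I H g \<in> \<E>)}"

definition box_entourages ::
    "('g, 'm) monoid_scheme \<Rightarrow> 'i set \<Rightarrow> ('i \<Rightarrow> 'g set)
      \<Rightarrow> (('i \<times> 'g set) \<times> ('i \<times> 'g set)) set set" where
  "box_entourages G I H =
     \<Inter>{\<E>. coarse_structure (box_points G I H) \<E> \<and>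
         coarse_connected (box_points G I H) \<E> \<and>
         coarse_invariant G (box_action G) \<E> \<and>
         (\<forall>g\<in>carrier G. box_Delta G I H g \<in> \<E>)}"

text \<open>
  For cosets \<open>C = x K\<close> and \<open>D = y K\<close> of a subgroup \<open>K\<close>, the products \<open>x h\<close> and \<open>y h'\<close> with
  \<open>h, h' \<in> K\<close> are exactly the elements of \<open>C\<close> and \<open>D\<close>, so the infimum of \<open>d (x h) (y h')\<close>
  is the following expression.
\<close>

definition coset_dist :: "('g \<Rightarrow> 'g \<Rightarrow> real) \<Rightarrow> 'g set \<Rightarrow> 'g set \<Rightarrow> real" where
  "coset_dist d C D = (INF (a, b)\<in>C \<times> D. d a b)"

definition proper_right_invariant_metric ::
    "('g, 'm) monoid_scheme \<Rightarrow> ('g \<Rightarrow> 'g \<Rightarrow> real) \<Rightarrow> bool" where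
  "proper_right_invariant_metric G d \<longleftrightarrow>
     Metric_space (carrier G) d \<and>
     (\<forall>x\<in>carrier G. \<forall>r. finite (Metric_space.mball (carrier G) d x r)) \<and>
     (\<forall>x\<in>carrier G. \<forall>y\<in>carrier G. \<forall>g\<in>carrier G.
        d (x \<otimes>\<^bsub>G\<^esub> g) (y \<otimes>\<^bsub>G\<^esub> g) = d x y)"

lemma box_action_closed:
  assumes "group G" "\<And>i. i \<in> I \<Longrightarrow> subgroup (H i) G"
    and "g \<in> carrier G" "x \<in> box_points G I H"
  shows "box_action G g x \<in> box_points G I H"
proof -
  from assms(4) obtain i a where x: "x = (i, a <#\<^bsub>G\<^esub> H i)" "i \<in> I" "a \<in> carrier G"
    by (auto simp: box_points_def LCOSETS_def)
  have "H i \<subseteq> carrier G"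
    using assms(2)[OF x(2)] by (rule subgroup.subset)
  then have "g <#\<^bsub>G\<^esub> (a <#\<^bsub>G\<^esub> H i) = (g \<otimes>\<^bsub>G\<^esub> a) <#\<^bsub>G\<^esub> H i"
    using assms(1,3) x(3) by (simp add: group.lcos_m_assoc)
  moreover have "g \<otimes>\<^bsub>G\<^esub> a \<in> carrier G"
    using assms(1,3) x(3) by (meson group.is_monoid monoid.m_closed)
  ultimately show ?thesis
    using x by (auto simp: box_action_def box_points_def LCOSETS_def)
qed

lemma coarse_structure_Inter:
  assumes "\<S> \<noteq> {}" "\<And>\<E>. \<E> \<in> \<S> \<Longrightarrow> coarse_structure X \<E>"
  shows "coarse_structure X (\<Inter>\<S>)"
proof -
  have *: "\<E> \<subseteq> Pow (X \<times> X)" "Id_on X \<in> \<E>"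
    "\<And>E F. E \<in> \<E> \<Longrightarrow> F \<subseteq> E \<Longrightarrow> F \<in> \<E>"
    "\<And>E F. E \<in> \<E> \<Longrightarrow> F \<in> \<E> \<Longrightarrow> E \<union> F \<in> \<E>"
    "\<And>E. E \<in> \<E> \<Longrightarrow> E\<inverse> \<in> \<E>"
    "\<And>E F. E \<in> \<E> \<Longrightarrow> F \<in> \<E> \<Longrightarrow> E O F \<in> \<E>" if "\<E> \<in> \<S>" for \<E>
    using assms(2)[OF that] by (simp_all add: coarse_structure_def)
  show ?thesis
    unfolding coarse_structure_def
  proof (intro conjI ballI allI impI)
    obtain \<E> where "\<E> \<in> \<S>" using assms(1) by blast
    then show "\<Inter>\<S> \<subseteq> Pow (X \<times> X)" using *(1)[of \<E>] by (meson Inter_lower subset_trans)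
  next
    fix E F assume "E \<in> \<Inter>\<S>" "F \<subseteq> E"
    then show "F \<in> \<Inter>\<S>" using *(3) by (meson InterD InterI)
  qed (auto intro: *(2,4,5,6))
qed

lemma
  assumes "group G" "\<And>i. i \<in> I \<Longrightarrow> subgroup (H i) G"
  shows coarse_structure_total_box: "coarse_structure (box_points G I H) (total_box_entourages G I H)"
    and coarse_structure_box: "coarse_structure (box_points G I H) (box_entourages G I H)"
    and coarse_connected_box: "coarse_connected (box_points G I H) (box_entourages G I H)"
proof -
  let ?X = "box_points G I H"
  let ?P = "Pow (?X \<times> ?X)"
  note act = box_action_closed[where I = I and H = H, OF assms]
  have cs: "coarse_structure ?X ?P"
    by (auto simp: coarse_structure_def)
  have cc: "coarse_connected ?X ?P"
    by (auto simp: coarse_connected_def)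
  have ci: "coarse_invariant G (box_action G) ?P"
    unfolding coarse_invariant_def using act by fastforce
  have D: "\<forall>g\<in>carrier G. box_Delta G I H g \<in> ?P"
    unfolding box_Delta_def using act by auto
  show "coarse_structure ?X (total_box_entourages G I H)"
    unfolding total_box_entourages_def
    by (rule coarse_structure_Inter) (use cs ci D in blast)+
  show "coarse_structure ?X (box_entourages G I H)"
    unfolding box_entourages_def
    by (rule coarse_structure_Inter) (use cs cc ci D in blast)+
  show "coarse_connected ?X (box_entourages G I H)"
    unfolding box_entourages_def coarse_connected_def by blast
qed

end

theory Submission
  imports Defs
begin

text \<open>
  The entourages of the total box space are the subsets of finite unions of the \<open>\<Delta>\<^sub>g\<close>, and those
  of the box space the subsets of such unions enlarged by a square \<open>B \<times> B\<close>, where \<open>B\<close> is the union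
  of finitely many components. Right invariance and properness of the metric say that a finite
  union of the \<open>\<Delta>\<^sub>g\<close> is the same as a uniform distance bound inside the components. Hence
  restricting a cover to the components gives a uniform family of covers, the finitely many finite
  components in \<open>B\<close> being uniformly bounded anyway. Conversely, covers of the components can be put
  together, with \<open>B\<close> as one single member.
\<close>

section \<open>Covers and finite unions of entourages\<close>

lemma distinct_members_disjoint_vimage:
  assumes "distinct_members_disjoint k \<U>"
  shows "distinct_members_disjoint k ((\<lambda>U. f -` U) ` \<U>)"
  unfolding distinct_members_disjoint_def
proof (intro allI impI)
  fix \<V> assume "\<V> \<subseteq> (\<lambda>U. f -` U) ` \<U>" "finite \<V>" "card \<V> = k"
  \<comment> \<open>One cover member is picked for each preimage in \<open>\<V>\<close>, so
    \<open>\<W>\<close> again has \<open>k\<close> elements although distinct sets may share a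
    preimage.\<close>
  then obtain \<W> where W: "\<W> \<subseteq> \<U>" "inj_on (\<lambda>U. f -` U) \<W>" "\<V> = (\<lambda>U. f -` U) ` \<W>"
    unfolding subset_image_inj by blast
  then have "finite \<W>" "card \<W> = k"
    using \<open>finite \<V>\<close> \<open>card \<V> = k\<close> by (auto simp: finite_image_iff card_image)
  then have "\<Inter>\<W> = {}"
    using assms W(1) by (auto simp: distinct_members_disjoint_def)
  then show "\<Inter>\<V> = {}"
    using W(3) by auto
qed

lemma coarse_structure_finite_Union:
  assumes "coarse_structure X \<E>" "finite \<F>" "\<F> \<subseteq> \<E>"
  shows "\<Union>\<F> \<in> \<E>"
  using assms(2,3)
proof (induction \<F> rule: finite_induct)
  case empty
  \<comment> \<open>The empty union is a subset of the diagonal.\<close>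
  show ?case
    using assms(1) by (auto simp: coarse_structure_def)
next
  case (insert E \<F>)
  then show ?case
    using assms(1) by (simp add: coarse_structure_def)
qed

text \<open>A finite set is a finite union of singletons, and connectedness makes those entourages.
  This will put the square over finitely many finite components into the box structure.\<close>

lemma coarse_connected_finite:
  assumes "coarse_structure X \<E>" "coarse_connected X \<E>" "finite E" "E \<subseteq> X \<times> X"
  shows "E \<in> \<E>"
proof -
  have "\<Union>((\<lambda>p. {p}) ` E) \<in> \<E>"
    using assms by (intro coarse_structure_finite_Union) (auto simp: coarse_connected_def)
  then show ?thesis
    by simp
qed

section \<open>The distance between cosets\<close>

lemma coset_dist_le:
  assumes "Metric_space M d" "C \<subseteq> M" "D \<subseteq> M" "a \<in> C" "b \<in> D"
  shows "coset_dist d C D \<le> d a b"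
proof -
  \<comment> \<open>A real infimum bounds its set from below only if the set has a lower bound;
    nonnegativity of \<open>d\<close> provides 0.\<close>
  have "bdd_below ((\<lambda>(a, b). d a b) ` (C \<times> D))"
    using Metric_space.nonneg[OF assms(1)] by (intro bdd_belowI[of _ 0]) auto
  from cINF_lower[OF this, of "(a, b)"] show ?thesis
    using assms(4,5) by (simp add: coset_dist_def)
qed

text \<open>The infimum is not known to be attained, so close representatives come only from a
  strict bound. This costs the extra 1 whenever a coset distance is turned into a
  translation.\<close>

lemma coset_dist_less_obtains:
  assumes "coset_dist d C D < r" "C \<noteq> {}" "D \<noteq> {}"
  obtains a b where "a \<in> C" "b \<in> D" "d a b < r"
proof -
  have "(\<lambda>(a, b). d a b) ` (C \<times> D) \<noteq> {}"
    using assms by auto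
  from cInf_lessD[OF this, of r] show ?thesis
    using assms(1) that by (auto simp: coset_dist_def)
qed

locale box_data = group G for G :: "('g, 'm) monoid_scheme" (structure) +
  fixes I :: "'i set" and H :: "'i \<Rightarrow> 'g set" and d :: "'g \<Rightarrow> 'g \<Rightarrow> real"
  assumes subgroups: "i \<in> I \<Longrightarrow> subgroup (H i) G"
    and finite_index: "i \<in> I \<Longrightarrow> finite (lcosets (H i))"
    and metric: "proper_right_invariant_metric G d"
begin

abbreviation X where "X \<equiv> box_points G I H"

abbreviation act where "act \<equiv> box_action G"

text \<open>
  The choice \<open>\<J> = {{}}\<close> gives the total box space; taking all finite subsets of \<open>I\<close> gives the
  box space.
\<close>

definition controlled :: "'i set set \<Rightarrow> (('i \<times> 'g set) \<times> ('i \<times> 'g set)) set set" where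
  "controlled \<J> = {E. E \<subseteq> X \<times> X \<and>
     (\<exists>F\<subseteq>carrier G. finite F \<and> (\<exists>J\<in>\<J>. \<forall>x y. (x, y) \<in> E \<longrightarrow>
       (\<exists>g\<in>F. y = act g x) \<or> fst x \<in> J \<and> fst y \<in> J))}"

lemma controlledI:
  assumes "E \<subseteq> X \<times> X" "F \<subseteq> carrier G" "finite F" "J \<in> \<J>"
    and "\<And>x y. (x, y) \<in> E \<Longrightarrow> (\<exists>g\<in>F. y = act g x) \<or> fst x \<in> J \<and> fst y \<in> J"
  shows "E \<in> controlled \<J>"
  unfolding controlled_def
  by (intro CollectI conjI exI[of _ F] bexI[of _ J] allI impI assms)

lemma controlledE:
  assumes "E \<in> controlled \<J>"
  obtains F J where "E \<subseteq> X \<times> X" "F \<subseteq> carrier G" "finite F" "J \<in> \<J>"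
    and "\<forall>x y. (x, y) \<in> E \<longrightarrow> (\<exists>g\<in>F. y = act g x) \<or> fst x \<in> J \<and> fst y \<in> J"
  using assms unfolding controlled_def by (elim CollectE conjE exE bexE)

section \<open>The action on tagged cosets\<close>

lemma fst_act [simp]: "fst (act g x) = fst x"
  by (simp add: box_action_def case_prod_beta)

lemma act_closed: "g \<in> carrier G \<Longrightarrow> x \<in> X \<Longrightarrow> act g x \<in> X"
  by (rule box_action_closed[OF is_group subgroups])

lemma coset_subset: "(i, C) \<in> X \<Longrightarrow> C \<subseteq> carrier G"
  using subgroups by (auto simp: box_points_def LCOSETS_def l_coset_def dest: subgroup.mem_carrier)

lemma coset_eq:
  assumes "(i, C) \<in> X" "a \<in> C"
  shows "C = a <# H i"
proof -
  obtain x where x: "i \<in> I" "x \<in> carrier G" "C = x <# H i"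
    using assms(1) by (auto simp: box_points_def LCOSETS_def)
  then show ?thesis
    using l_repr_independence[of a x "H i"] assms(2) subgroups by simp
qed

lemma coset_nonempty: "(i, C) \<in> X \<Longrightarrow> C \<noteq> {}"
  using subgroups by (fastforce simp: box_points_def LCOSETS_def l_coset_def dest: subgroup.one_closed)

lemma act_mult: "g \<in> carrier G \<Longrightarrow> h \<in> carrier G \<Longrightarrow> x \<in> X \<Longrightarrow> act g (act h x) = act (g \<otimes> h) x"
  using coset_subset by (cases x) (auto simp: box_action_def lcos_m_assoc)

lemma act_one: "x \<in> X \<Longrightarrow> act \<one> x = x"
  using coset_subset by (cases x) (auto simp: box_action_def lcos_mult_one)

lemma act_inv: "g \<in> carrier G \<Longrightarrow> x \<in> X \<Longrightarrow> act (inv g) (act g x) = x"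
  by (simp add: act_mult act_one)

text \<open>Every element of a coset represents it, so \<open>b \<otimes> inv a\<close> takes the
  coset of \<open>a\<close> to that of \<open>b\<close>. The freedom in \<open>a\<close> and
  \<open>b\<close> allows representatives that almost realise the coset distance.\<close>

lemma act_transporter:
  assumes "(i, C) \<in> X" "(i, D) \<in> X" "a \<in> C" "b \<in> D"
  shows "(i, D) = act (b \<otimes> inv a) (i, C)"
proof -
  have ab: "a \<in> carrier G" "b \<in> carrier G"
    using assms coset_subset by blast+
  have "i \<in> I"
    using assms(1) by (auto simp: box_points_def)
  then have "(b \<otimes> inv a) <# C = (b \<otimes> inv a \<otimes> a) <# H i"
    using coset_eq[OF assms(1,3)] lcos_m_assoc[of "H i"] ab subgroup.subset[OF subgroups] by simp
  also have "\<dots> = D"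
    using coset_eq[OF assms(2,4)] ab by (simp add: m_assoc)
  finally show ?thesis
    by (simp add: box_action_def)
qed

section \<open>Translation length and coset distance\<close>

sublocale metric: Metric_space "carrier G" d
  using metric by (simp add: proper_right_invariant_metric_def)

lemma finite_length_le: "finite {g \<in> carrier G. d \<one> g \<le> r}"
proof (rule finite_subset)
  \<comment> \<open>Properness is stated for open balls; radius \<open>r + 1\<close> makes room for
    the closed ball.\<close>
  show "{g \<in> carrier G. d \<one> g \<le> r} \<subseteq> metric.mball \<one> (r + 1)"
    by auto
  show "finite (metric.mball \<one> (r + 1))"
    using metric by (simp add: proper_right_invariant_metric_def)
qed

lemma right_invariant:
  "x \<in> carrier G \<Longrightarrow> y \<in> carrier G \<Longrightarrow> g \<in> carrier G \<Longrightarrow> d (x \<otimes> g) (y \<otimes> g) = d x y"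
  using metric by (simp add: proper_right_invariant_metric_def)

text \<open>Right invariance makes \<open>d a (g \<otimes> a)\<close> equal to
  \<open>d \<one> g\<close> for every \<open>a\<close>, so left translation by \<open>g\<close>
  displaces all cosets by at most the length of \<open>g\<close>.\<close>

lemma coset_dist_act:
  assumes "g \<in> carrier G" "(i, C) \<in> X" "(j, D) = act g (i, C)"
  shows "coset_dist d C D \<le> d \<one> g"
proof -
  obtain a where a: "a \<in> C"
    using coset_nonempty[OF assms(2)] by blast
  then have aG: "a \<in> carrier G"
    using coset_subset[OF assms(2)] by blast
  have D: "(j, D) \<in> X" "g \<otimes> a \<in> D"
    using assms act_closed[OF assms(1,2)] a by (auto simp: box_action_def l_coset_def)
  have "coset_dist d C D \<le> d a (g \<otimes> a)"
    using metric.Metric_space_axioms coset_subset[OF assms(2)] coset_subset[OF D(1)] a D(2)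
    by (rule coset_dist_le)
  also have "\<dots> = d \<one> g"
    using right_invariant[of \<one> g a] aG assms(1) by simp
  finally show ?thesis .
qed

text \<open>A converse to \<open>coset_dist_act\<close> up to 1: for representatives with
  \<open>d a b < r + 1\<close>, translation by \<open>b \<otimes> inv a\<close> takes one coset to
  the other, and right invariance gives this element length \<open>d a b\<close>.\<close>

lemma act_of_coset_dist_le:
  assumes "(i, C) \<in> X" "(i, D) \<in> X" "coset_dist d C D \<le> r"
  shows "\<exists>g\<in>{g \<in> carrier G. d \<one> g \<le> r + 1}. (i, D) = act g (i, C)"
proof -
  have "coset_dist d C D < r + 1"
    using assms(3) by simp
  then obtain a b where ab: "a \<in> C" "b \<in> D" "d a b < r + 1"
    using coset_nonempty[OF assms(1)] coset_nonempty[OF assms(2)] by (rule coset_dist_less_obtains)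
  then have G: "a \<in> carrier G" "b \<in> carrier G"
    using assms coset_subset by blast+
  have "d \<one> (b \<otimes> inv a) = d a b"
    using right_invariant[of a b "inv a"] G by simp
  then show ?thesis
    using act_transporter[OF assms(1,2) ab(1,2)] ab G by (intro bexI[of _ "b \<otimes> inv a"]) auto
qed

lemma coset_dist_bound:
  assumes "F \<subseteq> carrier G" "finite F"
  obtains S where "S > 0"
    "\<And>g i C j D. g \<in> F \<Longrightarrow> (i, C) \<in> X \<Longrightarrow> (j, D) = act g (i, C) \<Longrightarrow> coset_dist d C D \<le> S"
proof
  \<comment> \<open>The inserted 1 keeps the bound positive and the maximum defined even for empty
    \<open>F\<close>.\<close>
  let ?S = "Max (insert 1 (d \<one> ` F))"
  show "?S > 0"
    using assms(2) by (simp add: Max_gr_iff)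
  fix g i C j D assume g: "g \<in> F" "(i, C) \<in> X" "(j, D) = act g (i, C)"
  have "coset_dist d C D \<le> d \<one> g"
    using coset_dist_act g assms(1) by blast
  also have "d \<one> g \<le> ?S"
    using g(1) assms(2) by (intro Max_ge) auto
  finally show "coset_dist d C D \<le> ?S" .
qed

text \<open>Finite index enters here. It bounds the part of a box space entourage that is not given
  by translations.\<close>

lemma finite_components:
  assumes "finite J" "J \<subseteq> I"
  shows "finite (box_points G J H)"
  using assms finite_index by (auto simp: box_points_def)

section \<open>The invariant coarse structure of controlled sets\<close>

lemma box_Delta_controlled:
  assumes "g \<in> carrier G" "J \<in> \<J>"
  shows "box_Delta G I H g \<in> controlled \<J>"
  using assms act_closed by (intro controlledI[of _ "{g}" J]) (auto simp: box_Delta_def)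

text \<open>Inverting, uniting and multiplying finite sets of translations accounts for inverses,
  unions and compositions. Two exceptional index sets are merged into \<open>J \<union> J'\<close>,
  hence the directedness assumption; \<open>J\<^sub>0\<close> serves the diagonal.\<close>

lemma coarse_structure_controlled:
  assumes "J\<^sub>0 \<in> \<J>" and directed: "\<And>J K. J \<in> \<J> \<Longrightarrow> K \<in> \<J> \<Longrightarrow> J \<union> K \<in> \<J>"
  shows "coarse_structure X (controlled \<J>)"
  unfolding coarse_structure_def
proof (intro conjI ballI allI impI)
  show "controlled \<J> \<subseteq> Pow (X \<times> X)"
    by (auto simp: controlled_def)
  show "Id_on X \<in> controlled \<J>"
    using assms(1) act_one by (intro controlledI[of _ "{\<one>}" J\<^sub>0]) auto
next
  fix E D assume "E \<in> controlled \<J>" "D \<subseteq> E"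
  then show "D \<in> controlled \<J>"
    by (elim controlledE, intro controlledI) (assumption | blast)+
next
  fix E assume "E \<in> controlled \<J>"
  then obtain F J where E: "E \<subseteq> X \<times> X" "F \<subseteq> carrier G" "finite F" "J \<in> \<J>"
    "\<forall>x y. (x, y) \<in> E \<longrightarrow> (\<exists>g\<in>F. y = act g x) \<or> fst x \<in> J \<and> fst y \<in> J"
    by (rule controlledE)
  have "(\<exists>g\<in>m_inv G ` F. x = act g y) \<or> fst y \<in> J \<and> fst x \<in> J" if "(x, y) \<in> E" for x y
    using E(5)[rule_format, OF that] E(1,2) that act_inv[of _ x] by (metis imageI mem_Sigma_iff subsetD)
  then show "E\<inverse> \<in> controlled \<J>"
    using E(1-4) by (intro controlledI[of _ "m_inv G ` F" J]) auto
next
  fix E E' assume "E \<in> controlled \<J>" "E' \<in> controlled \<J>"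
  then obtain F J F' J' where E: "E \<subseteq> X \<times> X" "F \<subseteq> carrier G" "finite F" "J \<in> \<J>"
    "\<forall>x y. (x, y) \<in> E \<longrightarrow> (\<exists>g\<in>F. y = act g x) \<or> fst x \<in> J \<and> fst y \<in> J"
    and E': "E' \<subseteq> X \<times> X" "F' \<subseteq> carrier G" "finite F'" "J' \<in> \<J>"
    "\<forall>x y. (x, y) \<in> E' \<longrightarrow> (\<exists>g\<in>F'. y = act g x) \<or> fst x \<in> J' \<and> fst y \<in> J'"
    by (elim controlledE)
  show "E \<union> E' \<in> controlled \<J>"
  proof (rule controlledI[of _ "F \<union> F'" "J \<union> J'"])
    show "(\<exists>g\<in>F \<union> F'. y = act g x) \<or> fst x \<in> J \<union> J' \<and> fst y \<in> J \<union> J'"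
      if "(x, y) \<in> E \<union> E'" for x y
      using that E(5)[rule_format, of x y] E'(5)[rule_format, of x y] by blast
  qed (use E E' directed in auto)
  \<comment> \<open>In \<open>E O E'\<close> the pair from \<open>E\<close> comes first, so
    \<open>g\<close> acts before \<open>g'\<close>.\<close>
  let ?F = "(\<lambda>(g, g'). g' \<otimes> g) ` (F \<times> F')"
  show "E O E' \<in> controlled \<J>"
  proof (rule controlledI[of _ ?F "J \<union> J'"])
    fix x z assume "(x, z) \<in> E O E'"
    then obtain y where y: "(x, y) \<in> E" "(y, z) \<in> E'"
      by blast
    \<comment> \<open>If one of the two pairs is exceptional, a translation in the other cannot
      leave the component, so both endpoints lie over \<open>J \<union> J'\<close>.\<close>
    then consider g g' where "g \<in> F" "g' \<in> F'" "y = act g x" "z = act g' y"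
      | "fst x \<in> J \<union> J' \<and> fst z \<in> J \<union> J'"
      using E(5)[rule_format, OF y(1)] E'(5)[rule_format, OF y(2)] by (metis UnCI fst_act)
    then show "(\<exists>g\<in>?F. z = act g x) \<or> fst x \<in> J \<union> J' \<and> fst z \<in> J \<union> J'"
    proof cases
      case 1
      then have "z = act (g' \<otimes> g) x"
        using act_mult[of g' g x] E(1,2) E'(2) y by blast
      then show ?thesis
        using 1 by auto
    qed simp
  qed (use E E' directed in auto)
qed

text \<open>Moving both points by \<open>h\<close> conjugates the translation between them by
  \<open>h\<close>, and it keeps every point in its component, so \<open>J\<close> does not
  change.\<close>

lemma coarse_invariant_controlled: "coarse_invariant G act (controlled \<J>)"
  unfolding coarse_invariant_def
proof (intro ballI)
  fix h E assume h: "h \<in> carrier G" and "E \<in> controlled \<J>"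
  from this(2) obtain F J where E: "E \<subseteq> X \<times> X" "F \<subseteq> carrier G" "finite F" "J \<in> \<J>"
    "\<forall>x y. (x, y) \<in> E \<longrightarrow> (\<exists>g\<in>F. y = act g x) \<or> fst x \<in> J \<and> fst y \<in> J"
    by (rule controlledE)
  let ?F = "(\<lambda>g. h \<otimes> g \<otimes> inv h) ` F"
  show "(\<lambda>(x, y). (act h x, act h y)) ` E \<in> controlled \<J>"
  proof (rule controlledI[of _ ?F J])
    fix u v assume "(u, v) \<in> (\<lambda>(x, y). (act h x, act h y)) ` E"
    then obtain x y where xy: "(x, y) \<in> E" "u = act h x" "v = act h y"
      by auto
    from E(5)[rule_format, OF xy(1)] show "(\<exists>g\<in>?F. v = act g u) \<or> fst u \<in> J \<and> fst v \<in> J"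
    proof
      assume "\<exists>g\<in>F. y = act g x"
      then obtain g where g: "g \<in> F" "y = act g x" by blast
      have x: "x \<in> X" and gG: "g \<in> carrier G"
        using xy E(1,2) g by auto
      have "act (h \<otimes> g \<otimes> inv h) u = v"
        using x gG h by (simp add: xy(2,3) g(2) act_mult m_assoc)
      then show ?thesis
        using g(1) by blast
    qed (simp add: xy)
  qed (use E h act_closed in auto)
qed

text \<open>This gives minimality: a controlled set lies in a finite union of generators together
  with one square.\<close>

lemma controlled_subset:
  assumes "coarse_structure X \<E>" "\<And>g. g \<in> carrier G \<Longrightarrow> box_Delta G I H g \<in> \<E>"
    and "\<And>J. J \<in> \<J> \<Longrightarrow> box_points G (I \<inter> J) H \<times> box_points G (I \<inter> J) H \<in> \<E>"
  shows "controlled \<J> \<subseteq> \<E>"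
proof
  fix E assume "E \<in> controlled \<J>"
  then obtain F J where E: "E \<subseteq> X \<times> X" "F \<subseteq> carrier G" "finite F" "J \<in> \<J>"
    "\<forall>x y. (x, y) \<in> E \<longrightarrow> (\<exists>g\<in>F. y = act g x) \<or> fst x \<in> J \<and> fst y \<in> J"
    by (rule controlledE)
  \<comment> \<open>\<open>J\<close> is cut down to \<open>I\<close>, since it may contain indices
    outside \<open>I\<close>, whose cosets are not points of \<open>X\<close>.\<close>
  let ?B = "box_points G (I \<inter> J) H"
  have "\<Union>(insert (?B \<times> ?B) (box_Delta G I H ` F)) \<in> \<E>"
    using assms E by (intro coarse_structure_finite_Union) auto
  moreover have "E \<subseteq> \<Union>(insert (?B \<times> ?B) (box_Delta G I H ` F))"
  proof (rule subrelI)
    fix x y assume xy: "(x, y) \<in> E"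
    then have X: "x \<in> X" "y \<in> X"
      using E(1) by auto
    from E(5)[rule_format, OF xy] show "(x, y) \<in> \<Union>(insert (?B \<times> ?B) (box_Delta G I H ` F))"
    proof
      assume "\<exists>g\<in>F. y = act g x"
      then show ?thesis
        using X unfolding box_Delta_def by blast
    next
      assume "fst x \<in> J \<and> fst y \<in> J"
      then show ?thesis
        using X by (auto simp: box_points_def)
    qed
  qed
  ultimately show "E \<in> \<E>"
    using assms(1) unfolding coarse_structure_def by blast
qed

section \<open>The two box structures as structures of controlled sets\<close>

lemma total_box_entourages_eq: "total_box_entourages G I H = controlled {{}}"
proof
  have "coarse_structure X (controlled {{}})"
    by (rule coarse_structure_controlled) auto
  then show "total_box_entourages G I H \<subseteq> controlled {{}}"
    unfolding total_box_entourages_def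
    by (intro Inter_lower) (simp add: coarse_invariant_controlled box_Delta_controlled)
next
  have "controlled {{}} \<subseteq> \<E>"
    if "coarse_structure X \<E>" "\<forall>g\<in>carrier G. box_Delta G I H g \<in> \<E>" for \<E>
  proof (rule controlled_subset)
    \<comment> \<open>The only square is the one over no components. It is empty, and an entourage
      as the union of no entourages.\<close>
    show "box_points G (I \<inter> J) H \<times> box_points G (I \<inter> J) H \<in> \<E>" if "J \<in> {{}}" for J
      using coarse_structure_finite_Union[OF \<open>coarse_structure X \<E>\<close>, of "{}"] that
      by (simp add: box_points_def)
  qed (use that in auto)
  then show "controlled {{}} \<subseteq> total_box_entourages G I H"
    unfolding total_box_entourages_def by blast
qed

text \<open>Finite index sets are what connectedness adds: a single pair is controlled by the at
  most two components it touches, and conversely the square over finitely many finite components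
  lies in every connected coarse structure.\<close>

lemma box_entourages_eq: "box_entourages G I H = controlled {J. finite J \<and> J \<subseteq> I}"
proof
  let ?J = "{J. finite J \<and> J \<subseteq> I}"
  have "coarse_structure X (controlled ?J)"
    by (rule coarse_structure_controlled[of "{}"]) auto
  moreover have "coarse_connected X (controlled ?J)"
    unfolding coarse_connected_def
  proof (intro ballI)
    fix x y assume "x \<in> X" "y \<in> X"
    then show "{(x, y)} \<in> controlled ?J"
      by (intro controlledI[of _ "{}" "{fst x, fst y}"]) (auto simp: box_points_def)
  qed
  ultimately show "box_entourages G I H \<subseteq> controlled ?J"
    unfolding box_entourages_def
    by (intro Inter_lower) (auto simp: coarse_invariant_controlled intro: box_Delta_controlled)
next
  have "controlled {J. finite J \<and> J \<subseteq> I} \<subseteq> \<E>"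
    if "coarse_structure X \<E>" "coarse_connected X \<E>" "\<forall>g\<in>carrier G. box_Delta G I H g \<in> \<E>" for \<E>
  proof (rule controlled_subset)
    fix J assume "J \<in> {J. finite J \<and> J \<subseteq> I}"
    then show "box_points G (I \<inter> J) H \<times> box_points G (I \<inter> J) H \<in> \<E>"
      using finite_components[of "I \<inter> J"]
      by (intro coarse_connected_finite[OF that(1,2)]) (auto simp: box_points_def)
  qed (use that in auto)
  then show "controlled {J. finite J \<and> J \<subseteq> I} \<subseteq> box_entourages G I H"
    unfolding box_entourages_def by blast
qed

section \<open>Comparing covers of the whole space with covers of the components\<close>

lemma family_asdim_le_if_controlled:
  assumes "{} \<in> \<J>" "\<And>J. J \<in> \<J> \<Longrightarrow> finite J \<and> J \<subseteq> I"
    and "coarse_asdim_le X (controlled \<J>) n"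
  shows "family_asdim_le I (\<lambda>i. lcosets (H i)) (\<lambda>i. coset_dist d) n"
  unfolding family_asdim_le_def
proof (intro allI impI)
  fix R :: real assume "R > 0"
  \<comment> \<open>Cosets of one component at distance at most \<open>R\<close> are only known to
    differ by a translation of length up to \<open>R + 1\<close>.\<close>
  let ?F = "{g \<in> carrier G. d \<one> g \<le> R + 1}"
  define E where "E = {(x, y). x \<in> X \<and> y \<in> X \<and> (\<exists>g\<in>?F. y = act g x)}"
  have "E \<in> controlled \<J>"
    using assms(1) finite_length_le by (intro controlledI[of _ ?F "{}"]) (auto simp: E_def)
  then obtain \<U> where U: "is_cover X \<U>" "(\<Union>U\<in>\<U>. U \<times> U) \<in> controlled \<J>"
      "distinct_members_disjoint (n + 2) \<U>"
      "\<And>A. A \<noteq> {} \<Longrightarrow> A \<subseteq> X \<Longrightarrow> A \<times> A \<subseteq> E \<Longrightarrow> \<exists>U\<in>\<U>. A \<subseteq> U"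
    using assms(3) unfolding coarse_asdim_le_def by blast
  obtain F J where F: "F \<subseteq> carrier G" "finite F" "J \<in> \<J>"
    "\<forall>x y. (x, y) \<in> (\<Union>U\<in>\<U>. U \<times> U) \<longrightarrow> (\<exists>g\<in>F. y = act g x) \<or> fst x \<in> J \<and> fst y \<in> J"
    using U(2) by (rule controlledE)
  obtain S where S: "S > 0"
    "\<And>g i C j D. g \<in> F \<Longrightarrow> (i, C) \<in> X \<Longrightarrow> (j, D) = act g (i, C) \<Longrightarrow> coset_dist d C D \<le> S"
    using coset_dist_bound[OF F(1,2)] by metis
  let ?B = "box_points G J H"
  \<comment> \<open>One bound for all components: \<open>S\<close> handles the pairs related by
    \<open>F\<close>, and the maximum over the finite set \<open>?B \<times> ?B\<close> handles the
    exceptional pairs.\<close>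
  define T where "T = Max (insert S ((\<lambda>(x, y). coset_dist d (snd x) (snd y)) ` (?B \<times> ?B)))"
  have fin: "finite (insert S ((\<lambda>(x, y). coset_dist d (snd x) (snd y)) ` (?B \<times> ?B)))"
    using finite_components assms(2) F(3) by simp
  have "S \<le> T"
    unfolding T_def using fin by (intro Max_ge) auto
  have T: "coset_dist d C D \<le> T" if "U \<in> \<U>" "(i, C) \<in> U" "(i, D) \<in> U" for U i C D
  proof -
    have X: "(i, C) \<in> X" "(i, D) \<in> X"
      using that U(1) by (auto simp: is_cover_def)
    have "((i, C), (i, D)) \<in> (\<Union>U\<in>\<U>. U \<times> U)"
      using that by blast
    from F(4)[rule_format, OF this] show ?thesis
    proof
      assume "\<exists>g\<in>F. (i, D) = act g (i, C)"
      then show ?thesis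
        using S(2) X \<open>S \<le> T\<close> by (meson order_trans)
    next
      assume "fst (i, C) \<in> J \<and> fst (i, D) \<in> J"
      then have "((i, C), (i, D)) \<in> ?B \<times> ?B"
        using X by (auto simp: box_points_def)
      then show ?thesis
        unfolding T_def using fin by (intro Max_ge) force+
    qed
  qed
  show "\<exists>S>0. \<forall>i\<in>I. \<exists>\<U>. is_cover (lcosets (H i)) \<U> \<and> (\<forall>U\<in>\<U>. diameter_le (coset_dist d) U S) \<and>
      distinct_members_disjoint (n + 2) \<U> \<and>
      (\<forall>A. A \<noteq> {} \<longrightarrow> A \<subseteq> lcosets (H i) \<longrightarrow> diameter_le (coset_dist d) A R \<longrightarrow> (\<exists>U\<in>\<U>. A \<subseteq> U))"
  proof (rule exI[of _ T], intro conjI ballI)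
    show "T > 0"
      using \<open>S > 0\<close> \<open>S \<le> T\<close> by simp
    fix i assume i: "i \<in> I"
    \<comment> \<open>Each member is cut down to its slice over \<open>i\<close>. Members with equal
      slices merge, which does not raise the multiplicity.\<close>
    let ?U = "(\<lambda>U. Pair i -` U) ` \<U>"
    have "\<Union>?U = Pair i -` \<Union>\<U>"
      by auto
    also have "\<dots> = lcosets (H i)"
      using U(1) i by (auto simp: is_cover_def box_points_def)
    finally have "is_cover (lcosets (H i)) ?U"
      by (auto simp: is_cover_def)
    moreover have "\<forall>U\<in>?U. diameter_le (coset_dist d) U T"
      using T by (auto simp: diameter_le_def)
    moreover have "distinct_members_disjoint (n + 2) ?U"
      using U(3) by (rule distinct_members_disjoint_vimage)
    moreover have "\<exists>U\<in>?U. A \<subseteq> U"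
      if A: "A \<noteq> {}" "A \<subseteq> lcosets (H i)" "diameter_le (coset_dist d) A R" for A
    proof -
      have A_X: "(i, C) \<in> X" if "C \<in> A" for C
        using that A(2) i by (auto simp: box_points_def)
      then have "Pair i ` A \<subseteq> X"
        by blast
      moreover have "((i, C), (i, D)) \<in> E" if "C \<in> A" "D \<in> A" for C D
        using act_of_coset_dist_le[OF A_X A_X, OF that] A_X that A(3)
        by (simp add: E_def diameter_le_def)
      then have "Pair i ` A \<times> Pair i ` A \<subseteq> E"
        by blast
      ultimately have "\<exists>U\<in>\<U>. Pair i ` A \<subseteq> U"
        using U(4)[of "Pair i ` A"] A(1) by simp
      then show ?thesis
        by (simp add: image_subset_iff_subset_vimage)
    qed
    ultimately show "\<exists>\<U>. is_cover (lcosets (H i)) \<U> \<and> (\<forall>U\<in>\<U>. diameter_le (coset_dist d) U T) \<and>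
        distinct_members_disjoint (n + 2) \<U> \<and>
        (\<forall>A. A \<noteq> {} \<longrightarrow> A \<subseteq> lcosets (H i) \<longrightarrow> diameter_le (coset_dist d) A R \<longrightarrow> (\<exists>U\<in>\<U>. A \<subseteq> U))"
      by blast
  qed
qed

text \<open>The exceptional part of an entourage is absorbed by one large cover member, whose square
  is itself an allowed exceptional part. Over the remaining components the uniform covers
  suffice.\<close>

lemma controlled_asdim_le_if_family:
  assumes "\<And>J. J \<in> \<J> \<Longrightarrow> finite J \<and> J \<subseteq> I"
    and "family_asdim_le I (\<lambda>i. lcosets (H i)) (\<lambda>i. coset_dist d) n"
  shows "coarse_asdim_le X (controlled \<J>) n"
  unfolding coarse_asdim_le_def
proof
  fix E assume "E \<in> controlled \<J>"
  then obtain F J where E: "E \<subseteq> X \<times> X" "F \<subseteq> carrier G" "finite F" "J \<in> \<J>"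
    "\<forall>x y. (x, y) \<in> E \<longrightarrow> (\<exists>g\<in>F. y = act g x) \<or> fst x \<in> J \<and> fst y \<in> J"
    by (rule controlledE)
  have J: "J \<subseteq> I"
    using assms(1) E(4) by blast
  \<comment> \<open>\<open>R\<close> bounds how far \<open>F\<close> moves cosets, so a set with
    square in \<open>E\<close> has diameter at most \<open>R\<close> if it lies in a component
    outside \<open>J\<close>.\<close>
  obtain R where R: "R > 0"
    "\<And>g i C j D. g \<in> F \<Longrightarrow> (i, C) \<in> X \<Longrightarrow> (j, D) = act g (i, C) \<Longrightarrow> coset_dist d C D \<le> R"
    using coset_dist_bound[OF E(2,3)] by metis
  obtain S where "\<forall>i\<in>I. \<exists>\<U>. is_cover (lcosets (H i)) \<U> \<and> (\<forall>U\<in>\<U>. diameter_le (coset_dist d) U S) \<and>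
      distinct_members_disjoint (n + 2) \<U> \<and>
      (\<forall>A. A \<noteq> {} \<longrightarrow> A \<subseteq> lcosets (H i) \<longrightarrow> diameter_le (coset_dist d) A R \<longrightarrow> (\<exists>U\<in>\<U>. A \<subseteq> U))"
    using assms(2)[unfolded family_asdim_le_def, THEN spec, THEN mp, OF R(1)] by (elim exE conjE)
  \<comment> \<open>\<open>S\<close> is fixed before the index, so the chosen covers share one
    diameter bound.\<close>
  from bchoice[OF this] obtain \<U> where
    "\<forall>i\<in>I. is_cover (lcosets (H i)) (\<U> i) \<and> (\<forall>U\<in>\<U> i. diameter_le (coset_dist d) U S) \<and>
      distinct_members_disjoint (n + 2) (\<U> i) \<and>
      (\<forall>A. A \<noteq> {} \<longrightarrow> A \<subseteq> lcosets (H i) \<longrightarrow> diameter_le (coset_dist d) A R \<longrightarrow> (\<exists>U\<in>\<U> i. A \<subseteq> U))"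
    by (elim exE)
  then have U: "\<And>i. i \<in> I \<Longrightarrow> is_cover (lcosets (H i)) (\<U> i)"
    "\<And>i U. i \<in> I \<Longrightarrow> U \<in> \<U> i \<Longrightarrow> diameter_le (coset_dist d) U S"
    "\<And>i. i \<in> I \<Longrightarrow> distinct_members_disjoint (n + 2) (\<U> i)"
    "\<And>i A. i \<in> I \<Longrightarrow> A \<noteq> {} \<Longrightarrow> A \<subseteq> lcosets (H i) \<Longrightarrow> diameter_le (coset_dist d) A R \<Longrightarrow> \<exists>U\<in>\<U> i. A \<subseteq> U"
    by simp_all
  let ?B = "box_points G J H"
  \<comment> \<open>Only indices outside \<open>J\<close> contribute, which keeps \<open>?B\<close>
    disjoint from the other members.\<close>
  define \<W> where "\<W> = insert ?B (\<Union>i\<in>I - J. (`) (Pair i) ` \<U> i)"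
  have U_X: "Pair i ` U \<subseteq> X" if "i \<in> I" "U \<in> \<U> i" for i U
    using U(1)[OF that(1)] that by (auto simp: is_cover_def box_points_def)
  have B_X: "?B \<subseteq> X"
    using J by (auto simp: box_points_def)
  have "\<W> \<subseteq> Pow X"
    using U_X B_X by (auto simp: \<W>_def)
  moreover have "X \<subseteq> \<Union>\<W>"
  proof
    fix p assume p: "p \<in> X"
    obtain i C where iC: "p = (i, C)" "i \<in> I" "C \<in> lcosets (H i)"
      using p by (auto simp: box_points_def)
    then obtain U where "U \<in> \<U> i" "C \<in> U"
      using U(1)[of i] unfolding is_cover_def by blast
    then show "p \<in> \<Union>\<W>"
      using iC by (cases "i \<in> J") (auto simp: \<W>_def box_points_def)
  qed
  ultimately have "is_cover X \<W>"
    by (auto simp: is_cover_def)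
  moreover have "(\<Union>W\<in>\<W>. W \<times> W) \<in> controlled \<J>"
  proof (rule controlledI)
    show "(\<Union>W\<in>\<W>. W \<times> W) \<subseteq> X \<times> X"
      using \<open>is_cover X \<W>\<close> by (auto simp: is_cover_def)
    fix x y assume "(x, y) \<in> (\<Union>W\<in>\<W>. W \<times> W)"
    then consider "x \<in> ?B" "y \<in> ?B"
      | i U C D where "i \<in> I" "U \<in> \<U> i" "C \<in> U" "D \<in> U" "x = (i, C)" "y = (i, D)"
      unfolding \<W>_def by blast
    then show "(\<exists>g\<in>{g \<in> carrier G. d \<one> g \<le> S + 1}. y = act g x) \<or> fst x \<in> J \<and> fst y \<in> J"
    proof cases
      case 1
      then show ?thesis
        by (auto simp: box_points_def)
    next
      case 2
      then have "(i, C) \<in> X" "(i, D) \<in> X" "coset_dist d C D \<le> S"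
        using U_X U(2) by (auto simp: diameter_le_def)
      then show ?thesis
        using act_of_coset_dist_le 2(5,6) by blast
    qed
  qed (use finite_length_le E(4) in auto)
  moreover have "distinct_members_disjoint (n + 2) \<W>"
    unfolding distinct_members_disjoint_def
  proof (intro allI impI)
    fix \<V> assume V: "\<V> \<subseteq> \<W>" "finite \<V>" "card \<V> = n + 2"
    show "\<Inter>\<V> = {}"
    proof (rule ccontr)
      assume "\<Inter>\<V> \<noteq> {}"
      then obtain i C where iC: "\<And>V. V \<in> \<V> \<Longrightarrow> (i, C) \<in> V"
        by fast
      show False
      proof (cases "i \<in> J")
        case True
        \<comment> \<open>All other members lie over \<open>I - J\<close>, so only \<open>?B\<close>
          can contain the point, whereas \<open>n + 2\<close> is at least 2.\<close>
        have "\<V> \<subseteq> {?B}"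
          using V(1) iC True unfolding \<W>_def by fastforce
        from card_mono[OF _ this] show False
          using V(3) by simp
      next
        case False
        \<comment> \<open>Members containing \<open>(i, C)\<close> lie over \<open>i\<close>, so the
          count reduces to the cover of one component.\<close>
        have V_i: "\<V> \<subseteq> (`) (Pair i) ` \<U> i"
        proof
          fix W assume W: "W \<in> \<V>"
          then have "W \<noteq> ?B"
            using iC[OF W] False by (auto simp: box_points_def)
          then obtain j U where "U \<in> \<U> j" "W = Pair j ` U"
            using V(1) W unfolding \<W>_def by blast
          then show "W \<in> (`) (Pair i) ` \<U> i"
            using iC[OF W] by auto
        qed
        \<comment> \<open>As \<open>n + 2\<close> is positive, some member contains
          \<open>(i, C)\<close>, which is therefore a point of the space.\<close>
        obtain W where "W \<in> \<V>"
          using V(3) by fastforce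
        then have "(i, C) \<in> X"
          using iC V(1) \<open>\<W> \<subseteq> Pow X\<close> by blast
        then have i: "i \<in> I"
          by (simp add: box_points_def)
        obtain \<T> where T: "\<T> \<subseteq> \<U> i" "inj_on ((`) (Pair i)) \<T>" "\<V> = (`) (Pair i) ` \<T>"
          using V_i unfolding subset_image_inj by blast
        then have "finite \<T>" "card \<T> = n + 2"
          using V by (auto simp: finite_image_iff card_image)
        then have "\<Inter>\<T> = {}"
          using U(3)[OF i] T(1) by (auto simp: distinct_members_disjoint_def)
        moreover have "C \<in> \<Inter>\<T>"
        proof
          fix U assume "U \<in> \<T>"
          then show "C \<in> U"
            using iC[of "Pair i ` U"] T(3) by auto
        qed
        ultimately show False
          by blast
      qed
    qed
  qed
  moreover have "\<exists>W\<in>\<W>. A \<subseteq> W" if A: "A \<noteq> {}" "A \<subseteq> X" "A \<times> A \<subseteq> E" for A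
  proof -
    \<comment> \<open>One point decides the case: translations keep the component, so
      \<open>A\<close> lies either entirely over \<open>J\<close> or entirely in the component
      \<open>i\<close>.\<close>
    obtain i C where iC: "(i, C) \<in> A"
      using A(1) by fast
    have i: "i \<in> I"
      using iC A(2) by (auto simp: box_points_def)
    have rel: "(\<exists>g\<in>F. y = act g x) \<or> fst x \<in> J \<and> fst y \<in> J" if "x \<in> A" "y \<in> A" for x y
      using that A(3) E(5) by blast
    show ?thesis
    proof (cases "i \<in> J")
      case True
      have "fst y \<in> J" if "y \<in> A" for y
        using rel[OF iC that] True by auto
      then have "A \<subseteq> ?B"
        using A(2) by (force simp: box_points_def)
      then show ?thesis
        by (auto simp: \<W>_def)
    next
      case False
      have fst_A: "fst y = i" if "y \<in> A" for y
        using rel[OF iC that] False by auto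
      define A' where "A' = snd ` A"
      have A_eq: "A = Pair i ` A'"
        using fst_A by (force simp: A'_def image_image)
      have "coset_dist d D D' \<le> R" if "D \<in> A'" "D' \<in> A'" for D D'
      proof -
        have D: "(i, D) \<in> A" "(i, D') \<in> A"
          using that A_eq by auto
        then obtain g where "g \<in> F" "(i, D') = act g (i, D)"
          using rel[OF D] False by auto
        then show ?thesis
          using R(2) D(1) A(2) by blast
      qed
      moreover have "A' \<subseteq> lcosets (H i)"
        using A(2) A_eq by (auto simp: box_points_def)
      ultimately obtain U where "U \<in> \<U> i" "A' \<subseteq> U"
        using U(4)[OF i, of A'] A(1) by (auto simp: A'_def diameter_le_def)
      then have "Pair i ` U \<in> \<W>" "A \<subseteq> Pair i ` U"
        using i False A_eq by (auto simp: \<W>_def)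
      then show ?thesis
        by blast
    qed
  qed
  ultimately show "\<exists>\<U>. is_cover X \<U> \<and> (\<Union>U\<in>\<U>. U \<times> U) \<in> controlled \<J> \<and>
      distinct_members_disjoint (n + 2) \<U> \<and>
      (\<forall>A. A \<noteq> {} \<longrightarrow> A \<subseteq> X \<longrightarrow> A \<times> A \<subseteq> E \<longrightarrow> (\<exists>U\<in>\<U>. A \<subseteq> U))"
    by blast
qed

text \<open>The dimension conditions agree for every \<open>n\<close>, hence so do their least
  values, infinity included. The right-hand side does not mention \<open>\<J>\<close>, so both box
  structures have the same dimension.\<close>

lemma coarse_asdim_controlled:
  assumes "{} \<in> \<J>" "\<And>J. J \<in> \<J> \<Longrightarrow> finite J \<and> J \<subseteq> I"
  shows "coarse_asdim X (controlled \<J>) = family_asdim I (\<lambda>i. lcosets (H i)) (\<lambda>i. coset_dist d)"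
proof -
  have "coarse_asdim_le X (controlled \<J>) n \<longleftrightarrow>
      family_asdim_le I (\<lambda>i. lcosets (H i)) (\<lambda>i. coset_dist d) n" for n
    using family_asdim_le_if_controlled controlled_asdim_le_if_family assms by blast
  then have "coarse_asdim_le X (controlled \<J>) =
      family_asdim_le I (\<lambda>i. lcosets (H i)) (\<lambda>i. coset_dist d)"
    by (rule ext)
  then show ?thesis
    by (simp add: coarse_asdim_def family_asdim_def)
qed

end

theorem proposition3p5:
  fixes G :: "('g, 'm) monoid_scheme"
    and I :: "'i set"
    and H :: "'i \<Rightarrow> 'g set"
    and dG :: "'g \<Rightarrow> 'g \<Rightarrow> real"
  assumes "group G"
    and "countable (carrier G)"
    and "\<And>i. i \<in> I \<Longrightarrow> subgroup (H i) G"
    and "\<And>i. i \<in> I \<Longrightarrow> finite (lcosets\<^bsub>G\<^esub> (H i))"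
    and "proper_right_invariant_metric G dG"
  shows "coarse_asdim (box_points G I H) (total_box_entourages G I H)
           = coarse_asdim (box_points G I H) (box_entourages G I H)
       \<and> coarse_asdim (box_points G I H) (box_entourages G I H)
           = family_asdim I (\<lambda>i. lcosets\<^bsub>G\<^esub> (H i)) (\<lambda>i. coset_dist dG)"
proof -
  interpret box_data G I H dG
    by (intro box_data.intro box_data_axioms.intro assms)
  let ?asdim = "family_asdim I (\<lambda>i. lcosets\<^bsub>G\<^esub> (H i)) (\<lambda>i. coset_dist dG)"
  have "coarse_asdim X (total_box_entourages G I H) = ?asdim"
    unfolding total_box_entourages_eq by (rule coarse_asdim_controlled) auto
  moreover have "coarse_asdim X (box_entourages G I H) = ?asdim"
    unfolding box_entourages_eq by (rule coarse_asdim_controlled) auto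
  ultimately show ?thesis
    by simp
qed

end
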